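(* Let $x^\ast$ be a local minimizer of the MPVC and suppose MPVC-GMFCQ holds at $x^\ast$. Then $x^\ast$ is an M-stationary point of the MPVC.
   Context: The mathematical program with vanishing constraints (MPVC) is: minimize $f(x)$ over $x\in\mathbb{R}^n$ subject to $g_i(x)\le 0$ ($i=1,\dots,m$), $h_i(x)=0$ ($i=1,\dots,p$), $H_i(x)\ge 0$ and $G_i(x)H_i(x)\le 0$ ($i=1,\dots,q$), where all functions $f,g_i,h_i,G_i,H_i:\mathbb{R}^n\to\mathbb{R}$ are continuously differentiable. Let $\mathcal{C}$ be its feasible set. For $x^\ast\in\mathcal{C}$ put $I_g=\{i: g_i(x^\ast)=0\}$, $I_+=\{i:H_i(x^\ast)>0\}$, $I_{+0}=\{i:H_i(x^\ast)>0,G_i(x^\ast)=0\}$, $I_{+-}=\{i:H_i(x^\ast)>0,G_i(x^\ast)<0\}$, $I_{00}=\{i:H_i(x^\ast)=0,G_i(x^\ast)=0\}$, $I_{0+}=\{i:H_i(x^\ast)=0,G_i(x^\ast)>0\}$, $I_{0-}=\{i:H_i(x^\ast)=0,G_i(x^\ast)<0\}$. A vector $(\lambda,\mu,\eta^G,\eta^H)\in\mathbb{R}^m\times\mathbb{R}^p\times\mathbb{R}^q\times\mathbb{R}^q$ satisfies the M-sign conditions at $x^\ast$ if: $\lambda_i\ge0$ for $i\in I_g$, $\lambda_i=0$ for $i\notin I_g$; $\eta_i^G=0$ for $i\in I_{+-}\cup I_{0-}\cup I_{0+}$, $\eta_i^G\ge0$ for $i\in I_{+0}\cup I_{00}$;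 $\eta_i^H=0$ for $i\in I_+$, $\eta_i^H\ge0$ for $i\in I_{0-}$, $\eta_i^H$ free for $i\in I_{0+}$; $\eta_i^H\eta_i^G=0$ for $i\in I_{00}$. MPVC-GMFCQ holds at $x^\ast\in\mathcal{C}$ if there is no nonzero $(\lambda,\mu,\eta^G,\eta^H)$ satisfying the M-sign conditions at $x^\ast$ and $\sum_{i=1}^m\lambda_i\nabla g_i(x^\ast)+\sum_{i=1}^p\mu_i\nabla h_i(x^\ast)+\sum_{i=1}^q\eta_i^G\nabla G_i(x^\ast)-\sum_{i=1}^q\eta_i^H\nabla H_i(x^\ast)=0$. A feasible point $x^\ast$ is M-stationary if there is $(\lambda,\mu,\eta^G,\eta^H)$ satisfying the M-sign conditions at $x^\ast$ and $\nabla f(x^\ast)+\sum_{i=1}^m\lambda_i\nabla g_i(x^\ast)+\sum_{i=1}^p\mu_i\nabla h_i(x^\ast)+\sum_{i=1}^q\eta_i^G\nabla G_i(x^\ast)-\sum_{i=1}^q\eta_i^H\nabla H_i(x^\ast)=0$. *)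

theory Defs
  imports "HOL-Analysis.Analysis"
begin

text \<open>Meaningful only where \<open>\<phi>\<close> is differentiable.\<close>

definition gradient :: "(real ^ 'n \<Rightarrow> real) \<Rightarrow> real ^ 'n \<Rightarrow> real ^ 'n" where
  "gradient \<phi> x = (THE D. GDERIV \<phi> x :> D)"

definition cont_differentiable :: "(real ^ 'n \<Rightarrow> real) \<Rightarrow> bool" where
  "cont_differentiable \<phi> \<longleftrightarrow>
     (\<forall>x. \<phi> differentiable at x) \<and> continuous_on UNIV (gradient \<phi>)"

text \<open>
  The constraint families are indexed by \<open>{1..m}\<close>, \<open>{1..p}\<close>, \<open>{1..q}\<close>, each of which may be
  empty; the values of the families outside these ranges are irrelevant.
  \<open>obj\<close>, \<open>ineq\<close>, \<open>eqn\<close>, \<open>van_G\<close>, \<open>van_H\<close> stand for \<open>f\<close>, \<open>g\<close>, \<open>h\<close>, \<open>G\<close>, \<open>H\<close>.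
\<close>

record ('n::finite) mpvc =
  num_ineq :: nat
  num_eqn :: nat
  num_van :: nat
  obj :: "real ^ 'n \<Rightarrow> real"
  ineq :: "nat \<Rightarrow> real ^ 'n \<Rightarrow> real"
  eqn :: "nat \<Rightarrow> real ^ 'n \<Rightarrow> real"
  van_G :: "nat \<Rightarrow> real ^ 'n \<Rightarrow> real"
  van_H :: "nat \<Rightarrow> real ^ 'n \<Rightarrow> real"

definition smooth_data :: "'n::finite mpvc \<Rightarrow> bool" where
  "smooth_data P \<longleftrightarrow>
     cont_differentiable (obj P) \<and>
     (\<forall>i\<in>{1..num_ineq P}. cont_differentiable (ineq P i)) \<and>
     (\<forall>i\<in>{1..num_eqn P}. cont_differentiable (eqn P i)) \<and>
     (\<forall>i\<in>{1..num_van P}. cont_differentiable (van_G P i) \<and> cont_differentiable (van_H P i))"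

definition feasible_set :: "'n::finite mpvc \<Rightarrow> (real ^ 'n) set" where
  "feasible_set P = {x.
     (\<forall>i\<in>{1..num_ineq P}. ineq P i x \<le> 0) \<and>
     (\<forall>i\<in>{1..num_eqn P}. eqn P i x = 0) \<and>
     (\<forall>i\<in>{1..num_van P}. van_H P i x \<ge> 0 \<and> van_G P i x * van_H P i x \<le> 0)}"

definition local_minimizer :: "'n::finite mpvc \<Rightarrow> real ^ 'n \<Rightarrow> bool" where
  "local_minimizer P x \<longleftrightarrow>
     x \<in> feasible_set P \<and>
     (\<exists>\<epsilon>>0. \<forall>y \<in> feasible_set P \<inter> ball x \<epsilon>. obj P x \<le> obj P y)"

definition I_g :: "'n::finite mpvc \<Rightarrow> real ^ 'n \<Rightarrow> nat set" where
  "I_g P x = {i \<in> {1..num_ineq P}. ineq P i x = 0}"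

definition I_plus :: "'n::finite mpvc \<Rightarrow> real ^ 'n \<Rightarrow> nat set" where
  "I_plus P x = {i \<in> {1..num_van P}. van_H P i x > 0}"

definition I_plus_zero :: "'n::finite mpvc \<Rightarrow> real ^ 'n \<Rightarrow> nat set" where
  "I_plus_zero P x = {i \<in> {1..num_van P}. van_H P i x > 0 \<and> van_G P i x = 0}"

definition I_plus_minus :: "'n::finite mpvc \<Rightarrow> real ^ 'n \<Rightarrow> nat set" where
  "I_plus_minus P x = {i \<in> {1..num_van P}. van_H P i x > 0 \<and> van_G P i x < 0}"

definition I_zero_zero :: "'n::finite mpvc \<Rightarrow> real ^ 'n \<Rightarrow> nat set" where
  "I_zero_zero P x = {i \<in> {1..num_van P}. van_H P i x = 0 \<and> van_G P i x = 0}"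

definition I_zero_plus :: "'n::finite mpvc \<Rightarrow> real ^ 'n \<Rightarrow> nat set" where
  "I_zero_plus P x = {i \<in> {1..num_van P}. van_H P i x = 0 \<and> van_G P i x > 0}"

definition I_zero_minus :: "'n::finite mpvc \<Rightarrow> real ^ 'n \<Rightarrow> nat set" where
  "I_zero_minus P x = {i \<in> {1..num_van P}. van_H P i x = 0 \<and> van_G P i x < 0}"

text \<open>
  A multiplier vector \<open>(\<lambda>, \<mu>, \<eta>\<^sup>G, \<eta>\<^sup>H)\<close> is given by four functions on \<open>nat\<close>, of which only the
  entries in the index ranges matter. The conditions do not restrict \<open>\<mu>\<close>, nor \<open>\<eta>\<^sup>H\<close> on
  \<open>I_zero_plus\<close>; on \<open>I_zero_zero\<close> the only restriction on \<open>\<eta>\<^sup>H\<close> is the product condition.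
\<close>

definition M_sign ::
    "'n::finite mpvc \<Rightarrow> real ^ 'n \<Rightarrow> (nat \<Rightarrow> real) \<Rightarrow> (nat \<Rightarrow> real) \<Rightarrow> (nat \<Rightarrow> real) \<Rightarrow> (nat \<Rightarrow> real) \<Rightarrow> bool"
  where
  "M_sign P x lam mu etaG etaH \<longleftrightarrow>
     (\<forall>i \<in> I_g P x. lam i \<ge> 0) \<and>
     (\<forall>i \<in> {1..num_ineq P} - I_g P x. lam i = 0) \<and>
     (\<forall>i \<in> I_plus_minus P x \<union> I_zero_minus P x \<union> I_zero_plus P x. etaG i = 0) \<and>
     (\<forall>i \<in> I_plus_zero P x \<union> I_zero_zero P x. etaG i \<ge> 0) \<and>
     (\<forall>i \<in> I_plus P x. etaH i = 0) \<and>
     (\<forall>i \<in> I_zero_minus P x. etaH i \<ge> 0) \<and>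
     (\<forall>i \<in> I_zero_zero P x. etaH i * etaG i = 0)"

definition multiplier_nonzero ::
    "'n::finite mpvc \<Rightarrow> (nat \<Rightarrow> real) \<Rightarrow> (nat \<Rightarrow> real) \<Rightarrow> (nat \<Rightarrow> real) \<Rightarrow> (nat \<Rightarrow> real) \<Rightarrow> bool"
  where
  "multiplier_nonzero P lam mu etaG etaH \<longleftrightarrow>
     (\<exists>i\<in>{1..num_ineq P}. lam i \<noteq> 0) \<or>
     (\<exists>i\<in>{1..num_eqn P}. mu i \<noteq> 0) \<or>
     (\<exists>i\<in>{1..num_van P}. etaG i \<noteq> 0 \<or> etaH i \<noteq> 0)"

definition multiplier_gradient ::
    "'n::finite mpvc \<Rightarrow> real ^ 'n \<Rightarrow> (nat \<Rightarrow> real) \<Rightarrow> (nat \<Rightarrow> real) \<Rightarrow> (nat \<Rightarrow> real) \<Rightarrow> (nat \<Rightarrow> real) \<Rightarrow> real ^ 'n"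
  where
  "multiplier_gradient P x lam mu etaG etaH =
     (\<Sum>i=1..num_ineq P. lam i *\<^sub>R gradient (ineq P i) x)
     + (\<Sum>i=1..num_eqn P. mu i *\<^sub>R gradient (eqn P i) x)
     + (\<Sum>i=1..num_van P. etaG i *\<^sub>R gradient (van_G P i) x)
     - (\<Sum>i=1..num_van P. etaH i *\<^sub>R gradient (van_H P i) x)"

definition MPVC_GMFCQ :: "'n::finite mpvc \<Rightarrow> real ^ 'n \<Rightarrow> bool" where
  "MPVC_GMFCQ P x \<longleftrightarrow>
     x \<in> feasible_set P \<and>
     \<not> (\<exists>lam mu etaG etaH.
          multiplier_nonzero P lam mu etaG etaH \<and>
          M_sign P x lam mu etaG etaH \<and>
          multiplier_gradient P x lam mu etaG etaH = 0)"

definition M_stationary :: "'n::finite mpvc \<Rightarrow> real ^ 'n \<Rightarrow> bool" where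
  "M_stationary P x \<longleftrightarrow>
     x \<in> feasible_set P \<and>
     (\<exists>lam mu etaG etaH.
          M_sign P x lam mu etaG etaH \<and>
          gradient (obj P) x + multiplier_gradient P x lam mu etaG etaH = 0)"

end

theory Submission
  imports Defs
begin

text \<open>
  The squared distance of \<open>(G, H)\<close> to the set \<open>{(a, b). b \<ge> 0 \<and> a b \<le> 0}\<close> is
  \<open>(min H 0)\<^sup>2 + (min (max G 0) (max H 0))\<^sup>2\<close>. Adding it, together with the squared violations of
  the other constraints, as a penalty to \<open>f + \<bar>\<cdot> - x\<bar>\<^sup>2 / 2\<close> gives local minimizers converging to \<open>x\<close>.
  At each of them the distance term is touched from above by one of two smooth functions, so the
  gradient of a smooth function vanishes there; its coefficients satisfy the M-sign conditions of
  \<open>x\<close>, in particular one of \<open>\<eta>\<^sup>G\<close>, \<open>\<eta>\<^sup>H\<close> is always zero. These conditions are closed under scaling and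
  limits, so normalizing and passing to a subsequence yields multipliers of Fritz John type,
  and the constraint qualification makes the multiplier of \<open>f\<close> positive.
\<close>

subsection \<open>Gradients\<close>

lemma GDERIV_gradient:
  fixes \<phi> :: "real ^ 'n \<Rightarrow> real"
  assumes "\<phi> differentiable at x"
  shows "GDERIV \<phi> x :> gradient \<phi> x"
proof -
  from assms obtain \<phi>' where d: "(\<phi> has_derivative \<phi>') (at x)"
    by (auto simp: differentiable_def)
  then have "linear \<phi>'"
    by (rule has_derivative_linear)
  \<comment> \<open>Applied to 1, the adjoint of a linear functional gives its Riesz vector.\<close>
  then have "\<phi>' = (\<lambda>v. v \<bullet> adjoint \<phi>' 1)"
    by (simp add: adjoint_works)
  with d have D: "GDERIV \<phi> x :> adjoint \<phi>' 1"
    by (simp add: gderiv_def)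
  have "E = D" if "GDERIV \<phi> x :> E" "GDERIV \<phi> x :> D" for D E
    using has_derivative_unique[OF that[unfolded gderiv_def]]
    by (metis vector_eq_ldot)
  with D show ?thesis
    unfolding gradient_def by (metis (mono_tags, lifting) the_equality)
qed

lemma GDERIV_sum:
  assumes "\<And>i. i \<in> A \<Longrightarrow> GDERIV (f i) x :> D i"
  shows "GDERIV (\<lambda>y. \<Sum>i\<in>A. f i y) x :> (\<Sum>i\<in>A. D i)"
  using assms by (induction A rule: infinite_finite_induct) (auto simp: GDERIV_const GDERIV_add)

lemma GDERIV_local_min_zero:
  fixes \<phi> :: "'a::real_inner \<Rightarrow> real"
  assumes d: "GDERIV \<phi> x :> D" and min: "\<forall>\<^sub>F y in nhds x. \<phi> x \<le> \<phi> y"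
  shows "D = 0"
proof -
  from min obtain S where S: "open S" "x \<in> S" "\<And>y. y \<in> S \<Longrightarrow> \<phi> x \<le> \<phi> y"
    by (auto simp: eventually_nhds)
  have "(\<lambda>v. v \<bullet> D) = (\<lambda>v. 0)"
    using differential_zero_maxmin[OF \<open>x \<in> S\<close> \<open>open S\<close> d[unfolded gderiv_def]] S(3) by blast
  then have "D \<bullet> D = 0" by metis
  then show ?thesis by simp
qed

text \<open>Squaring removes the kink: at 0 the difference quotient is bounded by
  \<open>\<bar>h\<bar>\<close>, and elsewhere the function is locally \<open>t\<^sup>2\<close> or
  0.\<close>

lemma DERIV_max_zero_square:
  fixes t :: real
  shows "DERIV (\<lambda>t. (max t 0)\<^sup>2) t :> 2 * max t 0"
proof -
  consider "t > 0" | "t < 0" | "t = 0" by linarith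
  then show ?thesis
  proof cases
    case 1
    have "DERIV (\<lambda>t. t\<^sup>2) t :> 2 * max t 0"
      using 1 by (auto intro!: derivative_eq_intros)
    moreover have "\<forall>\<^sub>F s in nhds t. s\<^sup>2 = (max s 0)\<^sup>2"
      using eventually_nhds_in_open[of "{0<..}" t] 1 by (auto elim!: eventually_mono)
    ultimately show ?thesis
      by (subst DERIV_cong_ev[OF refl _ refl, symmetric])
  next
    case 2
    have "DERIV (\<lambda>t. 0) t :> 2 * max t 0"
      using 2 by (auto intro!: derivative_eq_intros)
    moreover have "\<forall>\<^sub>F s in nhds t. 0 = (max s 0)\<^sup>2"
      using eventually_nhds_in_open[of "{..<0}" t] 2 by (auto elim!: eventually_mono)
    ultimately show ?thesis
      by (subst DERIV_cong_ev[OF refl _ refl, symmetric])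
  next
    case 3
    have "((\<lambda>h::real. (max h 0)\<^sup>2 / h) \<longlongrightarrow> 0) (at 0)"
    proof (rule Lim_null_comparison)
      show "\<forall>\<^sub>F h::real in at 0. norm ((max h 0)\<^sup>2 / h) \<le> \<bar>h\<bar>"
        by (intro always_eventually) (auto simp: max_def power2_eq_square)
      show "((\<lambda>h::real. \<bar>h\<bar>) \<longlongrightarrow> 0) (at 0)"
        by (rule tendsto_eq_intros) (auto intro!: tendsto_eq_intros)
    qed
    then show ?thesis using 3 by (simp add: DERIV_def)
  qed
qed

lemma GDERIV_max_zero_square:
  assumes "GDERIV \<phi> x :> D"
  shows "GDERIV (\<lambda>y. (max (\<phi> y) 0)\<^sup>2) x :> (2 * max (\<phi> x) 0) *\<^sub>R D"
  using GDERIV_DERIV_compose[OF assms DERIV_max_zero_square] .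

lemma GDERIV_min_zero_square:
  assumes "GDERIV \<phi> x :> D"
  shows "GDERIV (\<lambda>y. (min (\<phi> y) 0)\<^sup>2) x :> (2 * min (\<phi> x) 0) *\<^sub>R D"
proof -
  have *: "max (- a) 0 = - min a 0" for a :: real by (simp add: max_def min_def)
  show ?thesis
    using GDERIV_max_zero_square[OF GDERIV_minus[OF assms]] by (simp add: *)
qed

lemma GDERIV_square:
  assumes "GDERIV \<phi> x :> D"
  shows "GDERIV (\<lambda>y. (\<phi> y)\<^sup>2) x :> (2 * \<phi> x) *\<^sub>R D"
proof -
  have "DERIV (\<lambda>t. t\<^sup>2) (\<phi> x) :> 2 * \<phi> x"
    by (auto intro!: derivative_eq_intros)
  from GDERIV_DERIV_compose[OF assms this] show ?thesis .
qed

lemma GDERIV_norm_square_diff: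
  "GDERIV (\<lambda>y. (norm (y - a))\<^sup>2 / 2) x :> x - a"
  unfolding gderiv_def power2_norm_eq_inner
  by (auto intro!: derivative_eq_intros simp: inner_commute)

subsection \<open>Convergence of penalized minimizers\<close>

text \<open>Along minimizers over a compact ball, \<open>n * \<psi>\<close> stays bounded, so a
  cluster point \<open>z\<close> has \<open>\<psi> z = 0\<close>. Comparison with \<open>x\<close>
  gives \<open>f z + (norm (z - x))\<^sup>2 / 2 \<le> f x \<le> f z\<close>; thus the quadratic term
  forces \<open>z = x\<close> even if \<open>x\<close> is not a strict minimizer.\<close>

lemma penalized_local_minimizers:
  fixes f \<psi> :: "'a::euclidean_space \<Rightarrow> real"
  assumes f: "continuous_on UNIV f" and \<psi>: "continuous_on UNIV \<psi>"
    and nonneg: "\<And>y. 0 \<le> \<psi> y" and x: "\<psi> x = 0"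
    and "\<epsilon> > 0" and min: "\<And>y. \<psi> y = 0 \<Longrightarrow> dist x y < \<epsilon> \<Longrightarrow> f x \<le> f y"
  obtains X c where "X \<longlonglongrightarrow> x" "\<And>n::nat. 0 \<le> c n"
    "\<And>n. \<forall>\<^sub>F y in nhds (X n). f (X n) + (norm (X n - x))\<^sup>2 / 2 + c n * \<psi> (X n)
                          \<le> f y + (norm (y - x))\<^sup>2 / 2 + c n * \<psi> y"
proof -
  define \<delta> where "\<delta> = \<epsilon> / 2"
  define B where "B = cball x \<delta>"
  define F where "F n y = f y + (norm (y - x))\<^sup>2 / 2 + real n * \<psi> y" for n y
  have \<delta>: "0 < \<delta>" "\<delta> < \<epsilon>" using \<open>\<epsilon> > 0\<close> by (auto simp: \<delta>_def)
  have B: "compact B" "B \<noteq> {}" "x \<in> B" using \<delta> by (auto simp: B_def)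
  have cont: "continuous_on B (F n)" for n
    unfolding F_def
    by (intro continuous_intros continuous_on_subset[OF f] continuous_on_subset[OF \<psi>]) auto
  have "\<exists>z\<in>B. \<forall>y\<in>B. F n z \<le> F n y" for n
    using continuous_attains_inf[OF B(1,2) cont] .
  then obtain Z where Z: "\<And>n. Z n \<in> B" "\<And>n y. y \<in> B \<Longrightarrow> F n (Z n) \<le> F n y"
    by metis
  obtain z r where z: "z \<in> B" and r: "strict_mono r" and lim: "(Z \<circ> r) \<longlonglongrightarrow> z"
    using B(1) Z(1) unfolding compact_def by metis
  \<comment> \<open>The lower bound \<open>f w\<close> of \<open>f\<close> on \<open>B\<close>
    serves to bound the penalty term by \<open>f x - f w\<close>.\<close>
  obtain w where w: "\<And>y. y \<in> B \<Longrightarrow> f w \<le> f y"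
    using continuous_attains_inf[OF B(1,2) continuous_on_subset[OF f]] by blast
  have le: "F n (Z n) \<le> f x" for n
    using Z(2)[OF B(3), of n] by (simp add: F_def x)
  have f_lim: "(\<lambda>n. f (Z (r n))) \<longlonglongrightarrow> f z"
    using continuous_on_tendsto_compose[OF f lim] by (simp add: o_def)
  have \<psi>_lim: "(\<lambda>n. \<psi> (Z (r n))) \<longlonglongrightarrow> \<psi> z"
    using continuous_on_tendsto_compose[OF \<psi> lim] by (simp add: o_def)
  have lim': "(\<lambda>n. Z (r n)) \<longlonglongrightarrow> z" using lim by (simp add: o_def)
  have "\<psi> (Z (r n)) \<le> (f x - f w) / real n" if "n > 0" for n
  proof -
    \<comment> \<open>A strictly increasing \<open>r\<close> satisfies
      \<open>n \<le> r n\<close>.\<close>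
    have "real n * \<psi> (Z (r n)) \<le> real (r n) * \<psi> (Z (r n))"
      using strict_mono_imp_increasing[OF r, of n] by (intro mult_right_mono nonneg) auto
    also have "\<dots> \<le> f x - f w"
      using le[of "r n"] w[OF Z(1)[of "r n"]] zero_le_power2[of "norm (Z (r n) - x)"]
      unfolding F_def by linarith
    finally show ?thesis using that by (simp add: field_simps)
  qed
  then have "\<forall>\<^sub>F n in sequentially. \<psi> (Z (r n)) \<le> (f x - f w) / real n"
    by (meson eventually_at_top_dense)
  then have "\<psi> z \<le> 0"
    using tendsto_le[OF _ lim_const_over_n \<psi>_lim] by simp
  with nonneg[of z] have \<psi>z: "\<psi> z = 0" by simp
  have "f (Z n) + (norm (Z n - x))\<^sup>2 / 2 \<le> f x" for n
    using le[of n] nonneg[of "Z n"] mult_nonneg_nonneg[of "real n" "\<psi> (Z n)"]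
    unfolding F_def by linarith
  moreover have "(\<lambda>n. f (Z (r n)) + (norm (Z (r n) - x))\<^sup>2 / 2) \<longlonglongrightarrow> f z + (norm (z - x))\<^sup>2 / 2"
    by (intro tendsto_intros f_lim lim') auto
  ultimately have "f z + (norm (z - x))\<^sup>2 / 2 \<le> f x"
    by (intro LIMSEQ_le_const2) auto
  moreover have "f x \<le> f z"
    using min[OF \<psi>z] z \<delta> by (auto simp: B_def)
  ultimately have "(norm (z - x))\<^sup>2 \<le> 0" by linarith
  then have zx: "z = x" by simp
  have "\<forall>\<^sub>F n in sequentially. dist (Z (r n)) x < \<delta>"
    using lim' \<delta>(1) unfolding zx by (simp add: tendsto_iff)
  \<comment> \<open>Dropping the first \<open>N\<close> indices leaves points interior to
    \<open>B\<close>, where minimality over \<open>B\<close> is local minimality.\<close>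
  then obtain N where N: "\<And>n. n \<ge> N \<Longrightarrow> dist (Z (r n)) x < \<delta>"
    by (auto simp: eventually_sequentially)
  show thesis
  proof (rule that)
    show "(\<lambda>n. Z (r (n + N))) \<longlonglongrightarrow> x"
      using LIMSEQ_ignore_initial_segment[OF lim', of N] by (simp add: zx)
    show "\<forall>\<^sub>F y in nhds (Z (r (n + N))).
        f (Z (r (n + N))) + (norm (Z (r (n + N)) - x))\<^sup>2 / 2 + real (r (n + N)) * \<psi> (Z (r (n + N)))
        \<le> f y + (norm (y - x))\<^sup>2 / 2 + real (r (n + N)) * \<psi> y" for n
    proof -
      have "\<forall>\<^sub>F y in nhds (Z (r (n + N))). y \<in> ball x \<delta>"
        using N[of "n + N"] by (intro eventually_nhds_in_open) (auto simp: dist_commute)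
      then show ?thesis
        by (rule eventually_mono) (use Z(2) in \<open>auto simp: F_def B_def\<close>)
    qed
  qed auto
qed

text \<open>The sequences are treated one at a time, since passing to a further subsequence
  preserves the convergence already obtained. It serves the finitely many multiplier
  components.\<close>

lemma finite_common_convergent_subseq:
  fixes F :: "(nat \<Rightarrow> real) set"
  assumes "finite F" "\<And>X. X \<in> F \<Longrightarrow> bounded (range X)"
  shows "\<exists>r. strict_mono r \<and> (\<forall>X\<in>F. convergent (X \<circ> r))"
  using assms
proof (induction F rule: finite_induct)
  case empty
  show ?case by (intro exI[of _ id]) (auto simp: strict_mono_def)
next
  case (insert X F)
  then obtain r where r: "strict_mono r" "\<And>Y. Y \<in> F \<Longrightarrow> convergent (Y \<circ> r)"
    by blast
  have "bounded (range (X \<circ> r))"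
    using insert.prems[of X] by (rule bounded_subset) auto
  then obtain l s where s: "strict_mono s" "(X \<circ> r \<circ> s) \<longlonglongrightarrow> l"
    using bounded_imp_convergent_subsequence[of "X \<circ> r"] by blast
  have "convergent (Y \<circ> (r \<circ> s))" if "Y \<in> insert X F" for Y
  proof (cases "Y = X")
    case True
    then show ?thesis using s(2) by (auto simp: convergent_def o_assoc)
  next
    case False
    then show ?thesis
      using that convergent_subseq_convergent[OF r(2) s(1)] by (auto simp: o_assoc)
  qed
  then show ?case using strict_mono_o[OF r(1) s(1)] by blast
qed

subsection \<open>The penalty function of an MPVC and its multipliers\<close>

definition penalty :: "'n::finite mpvc \<Rightarrow> real ^ 'n \<Rightarrow> real" where
  "penalty P y =
     (\<Sum>i=1..num_ineq P. (max (ineq P i y) 0)\<^sup>2)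
     + (\<Sum>i=1..num_eqn P. (eqn P i y)\<^sup>2)
     + (\<Sum>i=1..num_van P. (min (van_H P i y) 0)\<^sup>2
          + (min (max (van_G P i y) 0) (max (van_H P i y) 0))\<^sup>2)"

text \<open>
  Half the partial derivatives of the smooth majorant touching at \<open>y\<close>, with the sign of \<open>pen_H\<close>
  reversed because \<open>multiplier_gradient\<close> subtracts the terms of \<open>H\<close>.
\<close>

definition pen_G :: "'n::finite mpvc \<Rightarrow> real ^ 'n \<Rightarrow> nat \<Rightarrow> real" where
  "pen_G P y i =
     (if van_G P i y \<le> van_H P i y \<and> 0 < van_H P i y then max (van_G P i y) 0 else 0)"

definition pen_H :: "'n::finite mpvc \<Rightarrow> real ^ 'n \<Rightarrow> nat \<Rightarrow> real" where
  "pen_H P y i =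
     (if van_G P i y \<le> van_H P i y \<and> 0 < van_H P i y then 0 else - van_H P i y)"

lemma penalty_nonneg: "0 \<le> penalty P y"
  unfolding penalty_def by (intro add_nonneg_nonneg sum_nonneg) auto

lemma penalty_eq_0_iff: "penalty P y = 0 \<longleftrightarrow> y \<in> feasible_set P"
proof -
  \<comment> \<open>Once \<open>b \<ge> 0\<close>, the second equation says \<open>a \<le> 0\<close>
    or \<open>b = 0\<close>.\<close>
  have *: "min b 0 = 0 \<and> min (max a 0) (max b 0) = 0 \<longleftrightarrow> 0 \<le> b \<and> a * b \<le> 0" for a b :: real
    by (auto simp: min_def max_def mult_le_0_iff)
  have **: "max a 0 = 0 \<longleftrightarrow> a \<le> 0" for a :: real by (simp add: max_def)
  show ?thesis
    unfolding penalty_def feasible_set_def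
    by (subst add_nonneg_eq_0_iff, (intro add_nonneg_nonneg sum_nonneg; simp)+)+
      (simp add: sum_nonneg_eq_0_iff * ** Ball_def conj_assoc)
qed

lemma cont_differentiableD:
  assumes "cont_differentiable \<phi>"
  shows "GDERIV \<phi> x :> gradient \<phi> x" "continuous_on UNIV \<phi>" "continuous_on UNIV (gradient \<phi>)"
  using assms GDERIV_gradient
  by (auto simp: cont_differentiable_def intro!: continuous_at_imp_continuous_on
      differentiable_imp_continuous_within)

lemma continuous_on_penalty:
  assumes "smooth_data P"
  shows "continuous_on UNIV (penalty P)"
  using assms unfolding penalty_def smooth_data_def
  by (intro continuous_intros) (auto intro: cont_differentiableD)

lemma gradient_penalized_local_min:
  assumes smooth: "smooth_data P"
    and min: "\<forall>\<^sub>F y in nhds z. obj P z + (norm (z - x))\<^sup>2 / 2 + c * penalty P z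
                \<le> obj P y + (norm (y - x))\<^sup>2 / 2 + c * penalty P y"
    and "0 \<le> c"
  shows "gradient (obj P) z + (z - x) + (2 * c) *\<^sub>R
    multiplier_gradient P z (\<lambda>i. max (ineq P i z) 0) (\<lambda>i. eqn P i z) (pen_G P z) (pen_H P z) = 0"
proof -
  \<comment> \<open>The summands for the vanishing constraints need not be differentiable; at \<open>z\<close> each of them is
    touched from above by one of the smooth functions \<open>(min H 0)\<^sup>2 + (max G 0)\<^sup>2\<close> and \<open>H\<^sup>2\<close>.\<close>
  define A where "A i \<longleftrightarrow> van_G P i z \<le> van_H P i z \<and> 0 < van_H P i z" for i
  define T where "T i y = (if A i then (min (van_H P i y) 0)\<^sup>2 + (max (van_G P i y) 0)\<^sup>2
                           else (van_H P i y)\<^sup>2)" for i y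
  define \<psi> where "\<psi> y = (\<Sum>i=1..num_ineq P. (max (ineq P i y) 0)\<^sup>2)
     + (\<Sum>i=1..num_eqn P. (eqn P i y)\<^sup>2) + (\<Sum>i=1..num_van P. T i y)" for y
  \<comment> \<open>The inner minimum is at most \<open>max G 0\<close>, which settles the case
    \<open>A i\<close>. Otherwise one of the two squares vanishes and the other is at most
    \<open>H\<^sup>2\<close>.\<close>
  have T_ge: "(min (van_H P i y) 0)\<^sup>2 + (min (max (van_G P i y) 0) (max (van_H P i y) 0))\<^sup>2 \<le> T i y"
    for i y
    by (auto simp: T_def min_def max_def intro: power_mono)
  \<comment> \<open>\<open>A i\<close> selects the active branch at \<open>z\<close>: for
    \<open>H > 0\<close> the minimum is \<open>max G 0\<close> if \<open>G \<le> H\<close> and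
    \<open>H\<close> otherwise; for \<open>H \<le> 0\<close> only \<open>H\<^sup>2\<close>
    remains.\<close>
  have T_eq: "(min (van_H P i z) 0)\<^sup>2 + (min (max (van_G P i z) 0) (max (van_H P i z) 0))\<^sup>2 = T i z"
    for i
    by (auto simp: T_def A_def min_def max_def)
  have "penalty P y \<le> \<psi> y" for y
    unfolding penalty_def \<psi>_def by (intro add_mono sum_mono T_ge order_refl)
  moreover have "penalty P z = \<psi> z"
    unfolding penalty_def \<psi>_def by (simp only: T_eq)
  \<comment> \<open>As \<open>c \<ge> 0\<close>, a majorant that agrees with
    \<open>penalty P\<close> at \<open>z\<close> inherits the local minimum.\<close>
  ultimately have "\<forall>\<^sub>F y in nhds z. obj P z + (norm (z - x))\<^sup>2 / 2 + c * \<psi> z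
                \<le> obj P y + (norm (y - x))\<^sup>2 / 2 + c * \<psi> y"
    using min by (auto elim!: eventually_mono
        intro: order_trans[OF _ add_left_mono[OF mult_left_mono[OF _ \<open>0 \<le> c\<close>]]])
  moreover
  have T': "GDERIV (T i) z :> 2 *\<^sub>R (pen_G P z i *\<^sub>R gradient (van_G P i) z - pen_H P z i *\<^sub>R gradient (van_H P i) z)"
    if i: "i \<in> {1..num_van P}" for i
  proof -
    have GH: "GDERIV (van_G P i) z :> gradient (van_G P i) z" "GDERIV (van_H P i) z :> gradient (van_H P i) z"
      using smooth i by (auto simp: smooth_data_def cont_differentiableD)
    show ?thesis
    proof (cases "A i")
      case True
      have "GDERIV (T i) z :> (2 * min (van_H P i z) 0) *\<^sub>R gradient (van_H P i) z
          + (2 * max (van_G P i z) 0) *\<^sub>R gradient (van_G P i) z"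
        using GDERIV_add[OF GDERIV_min_zero_square[OF GH(2)] GDERIV_max_zero_square[OF GH(1)]] True
        unfolding T_def by simp
      \<comment> \<open>Here \<open>0 < van_H P i z\<close> makes the \<open>min\<close> factor
        vanish, so the gradient of \<open>H\<close> drops out, matching
        \<open>pen_H P z i = 0\<close>.\<close>
      then show ?thesis using True by (simp add: A_def pen_G_def pen_H_def)
    next
      case False
      then have "pen_G P z i = 0" "pen_H P z i = - van_H P i z"
        by (auto simp: A_def pen_G_def pen_H_def)
      moreover have "GDERIV (T i) z :> (2 * van_H P i z) *\<^sub>R gradient (van_H P i) z"
        using GDERIV_square[OF GH(2)] False unfolding T_def by simp
      ultimately show ?thesis by simp
    qed
  qed
  have "GDERIV \<psi> z :>
      (\<Sum>i=1..num_ineq P. (2 * max (ineq P i z) 0) *\<^sub>R gradient (ineq P i) z)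
      + (\<Sum>i=1..num_eqn P. (2 * eqn P i z) *\<^sub>R gradient (eqn P i) z)
      + (\<Sum>i=1..num_van P. 2 *\<^sub>R (pen_G P z i *\<^sub>R gradient (van_G P i) z - pen_H P z i *\<^sub>R gradient (van_H P i) z))"
    unfolding \<psi>_def using smooth
    by (intro GDERIV_add GDERIV_sum GDERIV_max_zero_square GDERIV_square T')
      (auto simp: smooth_data_def cont_differentiableD)
  then have "GDERIV \<psi> z :> 2 *\<^sub>R
      multiplier_gradient P z (\<lambda>i. max (ineq P i z) 0) (\<lambda>i. eqn P i z) (pen_G P z) (pen_H P z)"
    by (simp add: multiplier_gradient_def scaleR_sum_right scaleR_add_right scaleR_diff_right
        sum_subtractf algebra_simps)
  from GDERIV_mult[OF GDERIV_const[of c] this]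
  have "GDERIV (\<lambda>y. c * \<psi> y) z :> (2 * c) *\<^sub>R
      multiplier_gradient P z (\<lambda>i. max (ineq P i z) 0) (\<lambda>i. eqn P i z) (pen_G P z) (pen_H P z)"
    by (simp add: mult.commute)
  moreover have "GDERIV (obj P) z :> gradient (obj P) z"
    using smooth by (auto simp: smooth_data_def cont_differentiableD)
  ultimately show ?thesis
    using GDERIV_local_min_zero[OF GDERIV_add[OF GDERIV_add[OF _ GDERIV_norm_square_diff]]]
    by blast
qed

subsection \<open>Stability of the M-sign conditions\<close>

text \<open>The index sets are those of \<open>x\<close>, the multipliers those of a nearby
  \<open>y\<close>. Finitely many strict inequalities at \<open>x\<close> persist near
  \<open>x\<close>, and they decide which branch of \<open>pen_G\<close> and \<open>pen_H\<close> is
  taken wherever a condition depends on it.\<close>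

lemma M_sign_penalty:
  fixes P :: "'n::finite mpvc"
  assumes smooth: "smooth_data P" and x: "x \<in> feasible_set P"
  shows "\<forall>\<^sub>F y in nhds x.
    M_sign P x (\<lambda>i. max (ineq P i y) 0) (\<lambda>i. eqn P i y) (pen_G P y) (pen_H P y)"
proof -
  have less: "\<forall>\<^sub>F y in nhds x. \<phi> x < \<theta> x \<longrightarrow> \<phi> y < \<theta> y"
    if "continuous_on UNIV \<phi>" "continuous_on UNIV \<theta>" for \<phi> \<theta> :: "real ^ 'n \<Rightarrow> real"
  proof (cases "\<phi> x < \<theta> x")
    case True
    have "open {y. \<phi> y < \<theta> y}" using that by (rule open_Collect_less)
    then show ?thesis
      using eventually_nhds_in_open[of "{y. \<phi> y < \<theta> y}" x] True by (auto elim: eventually_mono)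
  qed simp
  have "\<forall>\<^sub>F y in nhds x. \<forall>i\<in>{1..num_ineq P}. ineq P i x < 0 \<longrightarrow> ineq P i y < 0"
    using smooth unfolding smooth_data_def
    by (intro eventually_ball_finite ballI less) (auto simp: cont_differentiableD)
  moreover
  \<comment> \<open>Comparing \<open>G\<close> with \<open>H\<close> directly fixes the branch:
    \<open>H < G\<close> gives \<open>pen_G = 0\<close> on \<open>I_zero_plus\<close>, while
    \<open>G < H\<close> and \<open>0 < H\<close> give \<open>pen_H = 0\<close> on
    \<open>I_plus\<close>.\<close>
  have "\<forall>\<^sub>F y in nhds x. \<forall>i\<in>{1..num_van P}. (van_G P i x < 0 \<longrightarrow> van_G P i y < 0)
      \<and> (0 < van_H P i x \<longrightarrow> 0 < van_H P i y)
      \<and> (van_G P i x < van_H P i x \<longrightarrow> van_G P i y < van_H P i y)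
      \<and> (van_H P i x < van_G P i x \<longrightarrow> van_H P i y < van_G P i y)"
    using smooth unfolding smooth_data_def
    by (intro eventually_ball_finite ballI eventually_conj less) (auto simp: cont_differentiableD)
  ultimately show ?thesis
  proof eventually_elim
    case (elim y)
    show ?case
      unfolding M_sign_def
    proof (intro conjI ballI)
      fix i assume "i \<in> {1..num_ineq P} - I_g P x"
      then have "i \<in> {1..num_ineq P}" "ineq P i x < 0"
        using x by (auto simp: I_g_def feasible_set_def less_le)
      then show "max (ineq P i y) 0 = 0"
        using elim(1) by fastforce
    next
      fix i assume "i \<in> I_plus_minus P x \<union> I_zero_minus P x \<union> I_zero_plus P x"
      with elim(2)[rule_format, of i] show "pen_G P y i = 0"
        by (auto simp: pen_G_def I_plus_minus_def I_zero_minus_def I_zero_plus_def)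
    next
      fix i assume "i \<in> I_plus P x"
      then have i: "i \<in> {1..num_van P}" "0 < van_H P i x"
        by (auto simp: I_plus_def)
      \<comment> \<open>Feasibility excludes \<open>G > 0\<close> where \<open>H > 0\<close>, hence
        \<open>G < H\<close> at \<open>x\<close>.\<close>
      with x have "van_G P i x * van_H P i x \<le> 0"
        by (auto simp: feasible_set_def)
      with i have "van_G P i x \<le> 0"
        by (simp add: mult_le_0_iff)
      with i elim(2) show "pen_H P y i = 0"
        by (fastforce simp: pen_H_def)
    next
      fix i assume "i \<in> I_zero_minus P x"
      with elim(2)[rule_format, of i] show "0 \<le> pen_H P y i"
        by (auto simp: pen_H_def I_zero_minus_def)
    \<comment> \<open>The remaining conditions hold at every \<open>y\<close>: maxima with 0 are
      nonnegative, and one of \<open>pen_G\<close>, \<open>pen_H\<close> is always 0.\<close>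
    qed (auto simp: pen_G_def pen_H_def)
  qed
qed

lemma M_sign_scale:
  assumes "M_sign P x lam mu etaG etaH" "0 \<le> t"
  shows "M_sign P x (\<lambda>i. t * lam i) (\<lambda>i. t * mu i) (\<lambda>i. t * etaG i) (\<lambda>i. t * etaH i)"
  using assms unfolding M_sign_def by auto

lemma multiplier_gradient_scale:
  "multiplier_gradient P x (\<lambda>i. t * lam i) (\<lambda>i. t * mu i) (\<lambda>i. t * etaG i) (\<lambda>i. t * etaH i)
   = t *\<^sub>R multiplier_gradient P x lam mu etaG etaH"
  unfolding multiplier_gradient_def
  by (simp add: scaleR_add_right scaleR_diff_right scaleR_sum_right)

text \<open>The index sets depend on \<open>x\<close> alone, so each condition is an equation or
  weak inequality on a fixed set, and such conditions are closed.\<close>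

lemma M_sign_limit:
  assumes M: "\<forall>\<^sub>F n in sequentially. M_sign P x (L n) (M n) (EG n) (EH n)"
    and L: "\<And>i. i \<in> {1..num_ineq P} \<Longrightarrow> (\<lambda>n. L n i) \<longlonglongrightarrow> lam i"
    and EG: "\<And>i. i \<in> {1..num_van P} \<Longrightarrow> (\<lambda>n. EG n i) \<longlonglongrightarrow> etaG i"
    and EH: "\<And>i. i \<in> {1..num_van P} \<Longrightarrow> (\<lambda>n. EH n i) \<longlonglongrightarrow> etaH i"
  shows "M_sign P x lam mu etaG etaH"
proof -
  have zero: "l = 0" if "X \<longlonglongrightarrow> l" "\<forall>\<^sub>F n in sequentially. X n = 0" for X and l :: real
    using LIMSEQ_unique[OF that(1) tendsto_eventually[OF that(2)]] .
  have nonneg: "0 \<le> l" if "X \<longlonglongrightarrow> l" "\<forall>\<^sub>F n in sequentially. 0 \<le> X n" for X and l :: real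
    using tendsto_lowerbound[OF that] by simp
  note defs = M_sign_def I_g_def I_plus_def I_plus_zero_def I_plus_minus_def I_zero_zero_def
    I_zero_plus_def I_zero_minus_def
  show ?thesis
    unfolding M_sign_def
  proof (intro conjI ballI)
    fix i assume "i \<in> I_g P x"
    with M show "0 \<le> lam i"
      by (intro nonneg[OF L]) (auto simp: defs elim!: eventually_mono)
  next
    fix i assume "i \<in> {1..num_ineq P} - I_g P x"
    with M show "lam i = 0"
      by (intro zero[OF L]) (auto simp: defs elim!: eventually_mono)
  next
    fix i assume "i \<in> I_plus_minus P x \<union> I_zero_minus P x \<union> I_zero_plus P x"
    with M show "etaG i = 0"
      by (intro zero[OF EG]) (auto simp: defs elim!: eventually_mono)
  next
    fix i assume "i \<in> I_plus_zero P x \<union> I_zero_zero P x"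
    with M show "0 \<le> etaG i"
      by (intro nonneg[OF EG]) (auto simp: defs elim!: eventually_mono)
  next
    fix i assume "i \<in> I_plus P x"
    with M show "etaH i = 0"
      by (intro zero[OF EH]) (auto simp: defs elim!: eventually_mono)
  next
    fix i assume "i \<in> I_zero_minus P x"
    with M show "0 \<le> etaH i"
      by (intro nonneg[OF EH]) (auto simp: defs elim!: eventually_mono)
  next
    fix i assume "i \<in> I_zero_zero P x"
    with M show "etaH i * etaG i = 0"
      by (intro zero[OF tendsto_mult[OF EH EG]]) (auto simp: defs elim!: eventually_mono)
  qed
qed

text \<open>Continuity of the gradients lets the base point move together with the
  multipliers.\<close>

lemma tendsto_multiplier_gradient:
  assumes smooth: "smooth_data P" and X: "X \<longlonglongrightarrow> x"
    and L: "\<And>i. i \<in> {1..num_ineq P} \<Longrightarrow> (\<lambda>n. L n i) \<longlonglongrightarrow> lam i"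
    and M: "\<And>i. i \<in> {1..num_eqn P} \<Longrightarrow> (\<lambda>n. M n i) \<longlonglongrightarrow> mu i"
    and EG: "\<And>i. i \<in> {1..num_van P} \<Longrightarrow> (\<lambda>n. EG n i) \<longlonglongrightarrow> etaG i"
    and EH: "\<And>i. i \<in> {1..num_van P} \<Longrightarrow> (\<lambda>n. EH n i) \<longlonglongrightarrow> etaH i"
  shows "(\<lambda>n. multiplier_gradient P (X n) (L n) (M n) (EG n) (EH n))
           \<longlonglongrightarrow> multiplier_gradient P x lam mu etaG etaH"
proof -
  have grad: "(\<lambda>n. gradient \<phi> (X n)) \<longlonglongrightarrow> gradient \<phi> x" if "cont_differentiable \<phi>" for \<phi>
    using continuous_on_tendsto_compose[OF cont_differentiableD(3)[OF that] X] by simp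
  show ?thesis
    unfolding multiplier_gradient_def using smooth
    by (intro tendsto_intros L M EG EH grad) (auto simp: smooth_data_def)
qed

section \<open>Fritz John multipliers and the constraint qualification\<close>

text \<open>The multipliers at \<open>X n\<close> may be unbounded, so the whole vector, including
  the coefficient 1 of the objective, is scaled to l1 norm 1. The norm survives in the limit, which
  makes the limit nontrivial.\<close>

lemma Fritz_John_M_stationary:
  assumes smooth: "smooth_data P" and loc: "local_minimizer P x"
  obtains \<alpha> lam mu etaG etaH where "0 \<le> \<alpha>" "\<alpha> \<noteq> 0 \<or> multiplier_nonzero P lam mu etaG etaH"
    "M_sign P x lam mu etaG etaH"
    "\<alpha> *\<^sub>R gradient (obj P) x + multiplier_gradient P x lam mu etaG etaH = 0"
proof -
  have feas: "x \<in> feasible_set P" using loc by (simp add: local_minimizer_def)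
  have obj: "cont_differentiable (obj P)" using smooth by (simp add: smooth_data_def)
  obtain \<epsilon> where "\<epsilon> > 0" and \<epsilon>: "\<And>y. penalty P y = 0 \<Longrightarrow> dist x y < \<epsilon> \<Longrightarrow> obj P x \<le> obj P y"
    using loc by (auto simp: local_minimizer_def penalty_eq_0_iff)
  obtain X c where X: "X \<longlonglongrightarrow> x" and c: "\<And>n::nat. 0 \<le> c n"
    and min: "\<And>n. \<forall>\<^sub>F y in nhds (X n). obj P (X n) + (norm (X n - x))\<^sup>2 / 2 + c n * penalty P (X n)
                          \<le> obj P y + (norm (y - x))\<^sup>2 / 2 + c n * penalty P y"
    using penalized_local_minimizers[OF cont_differentiableD(2)[OF obj] continuous_on_penalty[OF smooth]
        penalty_nonneg penalty_eq_0_iff[THEN iffD2, OF feas] \<open>\<epsilon> > 0\<close> \<epsilon>] by blast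
  define S where "S l u g h = (\<Sum>i=1..num_ineq P. \<bar>l i\<bar>) + (\<Sum>i=1..num_eqn P. \<bar>u i\<bar>)
      + (\<Sum>i=1..num_van P. \<bar>g i\<bar>) + (\<Sum>i=1..num_van P. \<bar>h i\<bar>)" for l u g h :: "nat \<Rightarrow> real"
  define s where
    "s n = S (\<lambda>i. max (ineq P i (X n)) 0) (\<lambda>i. eqn P i (X n)) (pen_G P (X n)) (pen_H P (X n))" for n
  \<comment> \<open>This is the l1 norm of the unscaled vector: 1 for the objective, and
    \<open>2 * c n\<close> times the penalty multipliers.\<close>
  define N where "N n = 1 + 2 * c n * s n" for n
  define t where "t n = 2 * c n / N n" for n
  define A where "A n = 1 / N n" for n
  define L where "L n i = t n * max (ineq P i (X n)) 0" for n i
  define M where "M n i = t n * eqn P i (X n)" for n i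
  define EG where "EG n i = t n * pen_G P (X n) i" for n i
  define EH where "EH n i = t n * pen_H P (X n) i" for n i
  have S_nonneg: "0 \<le> S l u g h" for l u g h
    unfolding S_def by (intro add_nonneg_nonneg sum_nonneg) auto
  have N: "1 \<le> N n" for n using c S_nonneg by (simp add: N_def s_def)
  have t: "0 \<le> t n" for n using c[of n] N[of n] by (simp add: t_def)
  have A: "0 \<le> A n" for n using N[of n] by (simp add: A_def)
  have S_scale: "S (\<lambda>i. s * l i) (\<lambda>i. s * u i) (\<lambda>i. s * g i) (\<lambda>i. s * h i) = s * S l u g h"
    if "0 \<le> s" for s l u g h
    using that unfolding S_def by (simp add: abs_mult sum_distrib_left distrib_left)
  have norm: "A n + S (L n) (M n) (EG n) (EH n) = 1" for n
  proof -
    have "S (L n) (M n) (EG n) (EH n) = t n * s n"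
      unfolding L_def M_def EG_def EH_def s_def by (rule S_scale[OF t])
    then have "A n + S (L n) (M n) (EG n) (EH n) = (1 + 2 * c n * s n) / N n"
      by (simp add: A_def t_def add_divide_distrib)
    then show ?thesis using N[of n] by (simp add: N_def)
  qed
  have le_S: "i \<in> {1..num_ineq P} \<Longrightarrow> \<bar>l i\<bar> \<le> S l u g h" "i \<in> {1..num_eqn P} \<Longrightarrow> \<bar>u i\<bar> \<le> S l u g h"
    "i \<in> {1..num_van P} \<Longrightarrow> \<bar>g i\<bar> \<le> S l u g h" "i \<in> {1..num_van P} \<Longrightarrow> \<bar>h i\<bar> \<le> S l u g h"
    for l u g h i
  proof -
    have nonneg: "0 \<le> (\<Sum>i=1..m. \<bar>v i\<bar>)" for m :: nat and v :: "nat \<Rightarrow> real"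
      by (rule sum_nonneg) simp
    have le: "\<bar>v i\<bar> \<le> (\<Sum>i=1..m. \<bar>v i\<bar>)" if "i \<in> {1..m}" for m and v :: "nat \<Rightarrow> real"
      using that by (rule member_le_sum) auto
    note sums = nonneg[of l "num_ineq P"] nonneg[of u "num_eqn P"]
      nonneg[of g "num_van P"] nonneg[of h "num_van P"]
    show "i \<in> {1..num_ineq P} \<Longrightarrow> \<bar>l i\<bar> \<le> S l u g h"
      unfolding S_def using sums le[of "num_ineq P" l] by linarith
    show "i \<in> {1..num_eqn P} \<Longrightarrow> \<bar>u i\<bar> \<le> S l u g h"
      unfolding S_def using sums le[of "num_eqn P" u] by linarith
    show "i \<in> {1..num_van P} \<Longrightarrow> \<bar>g i\<bar> \<le> S l u g h"
      unfolding S_def using sums le[of "num_van P" g] by linarith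
    show "i \<in> {1..num_van P} \<Longrightarrow> \<bar>h i\<bar> \<le> S l u g h"
      unfolding S_def using sums le[of "num_van P" h] by linarith
  qed
  define F where "F = {A} \<union> (\<lambda>i n. L n i) ` {1..num_ineq P} \<union> (\<lambda>i n. M n i) ` {1..num_eqn P}
      \<union> (\<lambda>i n. EG n i) ` {1..num_van P} \<union> (\<lambda>i n. EH n i) ` {1..num_van P}"
  have "\<bar>Y n\<bar> \<le> 1" if "Y \<in> F" for Y n
  proof -
    have S: "S (L n) (M n) (EG n) (EH n) \<le> 1" and "A n \<le> 1"
      using norm[of n] A[of n] S_nonneg[of "L n" "M n" "EG n" "EH n"] by linarith+
    with that A[of n] show ?thesis
      unfolding F_def using le_S[THEN order_trans[OF _ S]] by auto
  qed
  then have "bounded (range Y)" if "Y \<in> F" for Y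
    using that by (intro boundedI[of _ 1]) auto
  moreover have "finite F" by (simp add: F_def)
  ultimately obtain r where r: "strict_mono r" and conv: "\<And>Y. Y \<in> F \<Longrightarrow> convergent (Y \<circ> r)"
    using finite_common_convergent_subseq by metis
  \<comment> \<open>Outside the index ranges these limits may be arbitrary values of
    \<open>lim\<close>; only indices in range are used.\<close>
  define \<alpha> where "\<alpha> = lim (A \<circ> r)"
  define lam where "lam i = lim ((\<lambda>n. L n i) \<circ> r)" for i
  define mu where "mu i = lim ((\<lambda>n. M n i) \<circ> r)" for i
  define etaG where "etaG i = lim ((\<lambda>n. EG n i) \<circ> r)" for i
  define etaH where "etaH i = lim ((\<lambda>n. EH n i) \<circ> r)" for i
  have conv': "(\<lambda>n. Y (r n)) \<longlonglongrightarrow> lim (Y \<circ> r)" if "Y \<in> F" for Y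
    using conv[OF that] by (simp add: convergent_LIMSEQ_iff o_def)
  have lims: "(\<lambda>n. A (r n)) \<longlonglongrightarrow> \<alpha>"
    "\<And>i. i \<in> {1..num_ineq P} \<Longrightarrow> (\<lambda>n. L (r n) i) \<longlonglongrightarrow> lam i"
    "\<And>i. i \<in> {1..num_eqn P} \<Longrightarrow> (\<lambda>n. M (r n) i) \<longlonglongrightarrow> mu i"
    "\<And>i. i \<in> {1..num_van P} \<Longrightarrow> (\<lambda>n. EG (r n) i) \<longlonglongrightarrow> etaG i"
    "\<And>i. i \<in> {1..num_van P} \<Longrightarrow> (\<lambda>n. EH (r n) i) \<longlonglongrightarrow> etaH i"
    unfolding \<alpha>_def lam_def mu_def etaG_def etaH_def by (rule conv', simp add: F_def)+
  have Xr: "(\<lambda>n. X (r n)) \<longlonglongrightarrow> x"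
    using LIMSEQ_subseq_LIMSEQ[OF X r] by (simp add: o_def)
  show thesis
  proof (rule that)
    show "0 \<le> \<alpha>"
      using LIMSEQ_le_const[OF lims(1)] A by blast
    have "(\<lambda>n. A (r n) + S (L (r n)) (M (r n)) (EG (r n)) (EH (r n))) \<longlonglongrightarrow> \<alpha> + S lam mu etaG etaH"
      unfolding S_def by (intro tendsto_intros lims)
    then have "\<alpha> + S lam mu etaG etaH = 1"
      unfolding norm by (simp add: LIMSEQ_const_iff)
    then show "\<alpha> \<noteq> 0 \<or> multiplier_nonzero P lam mu etaG etaH"
      \<comment> \<open>If all entries vanished, the sum would be 0 instead of 1.\<close>
      by - (rule ccontr, auto simp: multiplier_nonzero_def S_def)
    have "\<forall>\<^sub>F n in sequentially. M_sign P x (L (r n)) (M (r n)) (EG (r n)) (EH (r n))"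
      using eventually_compose_filterlim[OF M_sign_penalty[OF smooth feas] Xr]
      unfolding L_def M_def EG_def EH_def by (auto elim!: eventually_mono intro: M_sign_scale t)
    then show "M_sign P x lam mu etaG etaH"
      using lims(2,4,5) by (rule M_sign_limit)
    have "A n *\<^sub>R (gradient (obj P) (X n) + (X n - x))
        + multiplier_gradient P (X n) (L n) (M n) (EG n) (EH n) = 0" for n
    proof -
      \<comment> \<open>Since \<open>t n = A n * (2 * c n)\<close>, the claim is the stationarity
        equation at \<open>X n\<close> multiplied by \<open>A n\<close>.\<close>
      have "multiplier_gradient P (X n) (L n) (M n) (EG n) (EH n) = A n *\<^sub>R (2 * c n) *\<^sub>R
          multiplier_gradient P (X n) (\<lambda>i. max (ineq P i (X n)) 0) (\<lambda>i. eqn P i (X n))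
            (pen_G P (X n)) (pen_H P (X n))"
        unfolding L_def M_def EG_def EH_def multiplier_gradient_scale by (simp add: t_def A_def)
      then show ?thesis
        using gradient_penalized_local_min[OF smooth min c, of n]
        by (metis scaleR_add_right scaleR_zero_right)
    qed
    moreover have "(\<lambda>n. A (r n) *\<^sub>R (gradient (obj P) (X (r n)) + (X (r n) - x))
        + multiplier_gradient P (X (r n)) (L (r n)) (M (r n)) (EG (r n)) (EH (r n)))
        \<longlonglongrightarrow> \<alpha> *\<^sub>R (gradient (obj P) x + (x - x)) + multiplier_gradient P x lam mu etaG etaH"
      by (intro tendsto_intros lims tendsto_multiplier_gradient smooth Xr
          continuous_on_tendsto_compose[OF cont_differentiableD(3)[OF obj]]) auto
    ultimately show "\<alpha> *\<^sub>R gradient (obj P) x + multiplier_gradient P x lam mu etaG etaH = 0"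
      by (simp add: LIMSEQ_const_iff)
  qed
qed

theorem theorem3p4:
  fixes P :: "'n::finite mpvc" and x :: "real ^ 'n"
  assumes "smooth_data P"
    and "local_minimizer P x"
    and "MPVC_GMFCQ P x"
  shows "M_stationary P x"
proof -
  obtain \<alpha> lam mu etaG etaH where FJ: "0 \<le> \<alpha>" "\<alpha> \<noteq> 0 \<or> multiplier_nonzero P lam mu etaG etaH"
    "M_sign P x lam mu etaG etaH"
    "\<alpha> *\<^sub>R gradient (obj P) x + multiplier_gradient P x lam mu etaG etaH = 0"
    using Fritz_John_M_stationary[OF assms(1,2)] .
  \<comment> \<open>With \<open>\<alpha> = 0\<close> the multipliers would be nonzero with vanishing
    \<open>multiplier_gradient\<close>, which MPVC-GMFCQ forbids.\<close>
  have "\<alpha> \<noteq> 0"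
    using FJ assms(3) by (auto simp: MPVC_GMFCQ_def)
  then have "gradient (obj P) x + (1 / \<alpha>) *\<^sub>R multiplier_gradient P x lam mu etaG etaH
      = (1 / \<alpha>) *\<^sub>R (\<alpha> *\<^sub>R gradient (obj P) x + multiplier_gradient P x lam mu etaG etaH)"
    by (simp add: scaleR_add_right)
  also have "\<dots> = 0" by (simp add: FJ(4))
  finally show ?thesis
    using assms(3) M_sign_scale[OF FJ(3), of "1 / \<alpha>"] FJ(1)
    unfolding M_stationary_def MPVC_GMFCQ_def multiplier_gradient_scale[symmetric] by auto
qed

end
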